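(* Let $n\ge1$, $\widetilde\rho>0$, $k\neq 0$, and suppose that $$-1\le kC_k<1 .$$ Then $E_{q,B}<E_c<E_{q,F}$; that is, $E(M_k)<E_c$ if $k>0$ (boson case), and $E(M_k)>E_c$ if $k<0$ (fermion case).
   Context: $\Omega\subset\mathbb{R}^n$ is a bounded domain of volume $V_\Omega$, and $\widetilde\rho>0$ is a fixed total density. For $k\in\mathbb{R}$, $C_k$ denotes the (unique, when it exists) constant with $C_k>0$, $kC_k<1$ and $$V_\Omega\int_{\mathbb{R}^n}\frac{C_k e^{-|v|^2/2}}{1-kC_ke^{-|v|^2/2}}\,dv=\widetilde\rho,$$ and the global Maxwellian is $M_k(v)=\dfrac{C_ke^{-|v|^2/2}}{1-kC_ke^{-|v|^2/2}}$. The energy is $E(M_k)=\frac12\int_\Omega\int_{\mathbb{R}^n}|v|^2M_k\,dv\,dx$, written $E_{q,B}$ when $k>0$ and $E_{q,F}$ when $k<0$; the classical energy is $E_c=E(M_0)=n\widetilde\rho/2$, with the same $\Omega$ and $\widetilde\rho$. *)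

theory Defs
  imports "HOL-Analysis.Analysis"
begin

definition bounded_domain :: "(real ^ 'n) set \<Rightarrow> bool" where
  "bounded_domain \<Omega> \<longleftrightarrow> \<Omega> \<noteq> {} \<and> open \<Omega> \<and> connected \<Omega> \<and> bounded \<Omega>"

definition maxwellian :: "real \<Rightarrow> real \<Rightarrow> real ^ 'n \<Rightarrow> real" where
  "maxwellian k C v = C * exp (- (norm v)\<^sup>2 / 2) / (1 - k * C * exp (- (norm v)\<^sup>2 / 2))"

text \<open>
  Since the density is positive and a Bochner integral that does not converge is 0, the mass
  equation below includes convergence of the integral.
\<close>

definition is_normalizing_const :: "(real ^ 'n) set \<Rightarrow> real \<Rightarrow> real \<Rightarrow> real \<Rightarrow> bool" where
  "is_normalizing_const \<Omega> \<rho> k C \<longleftrightarrow>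
     C > 0 \<and> k * C < 1 \<and>
     measure lborel \<Omega> * (LINT v|lborel. maxwellian k C (v :: real ^ 'n)) = \<rho>"

text \<open>
  The constant need not exist for large positive \<open>k\<close> (Bose case, dimension at least 3);
  when it exists it is unique, because the mass is strictly increasing in \<open>C\<close>.
\<close>

definition normalizing_const :: "(real ^ 'n) set \<Rightarrow> real \<Rightarrow> real \<Rightarrow> real" where
  "normalizing_const \<Omega> \<rho> k = (THE C. is_normalizing_const \<Omega> \<rho> k C)"

definition global_maxwellian :: "(real ^ 'n) set \<Rightarrow> real \<Rightarrow> real \<Rightarrow> real ^ 'n \<Rightarrow> real" where
  "global_maxwellian \<Omega> \<rho> k = maxwellian k (normalizing_const \<Omega> \<rho> k)"

text \<open>The energy of a spatially homogeneous density \<open>f\<close>, i.e. one depending on \<open>v\<close> only.\<close>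

definition energy :: "(real ^ 'n) set \<Rightarrow> (real ^ 'n \<Rightarrow> real) \<Rightarrow> real" where
  "energy \<Omega> f = 1 / 2 * (LINT x:\<Omega>|lborel. (LINT v|lborel. (norm v)\<^sup>2 * f v))"

definition quantum_energy :: "(real ^ 'n) set \<Rightarrow> real \<Rightarrow> real \<Rightarrow> real" where
  "quantum_energy \<Omega> \<rho> k = energy \<Omega> (global_maxwellian \<Omega> \<rho> k)"

definition classical_energy :: "(real ^ 'n) set \<Rightarrow> real \<Rightarrow> real" where
  "classical_energy \<Omega> \<rho> = energy \<Omega> (global_maxwellian \<Omega> \<rho> 0)"

end

theory Submission
  imports Defs "HOL-Probability.Distributions"
begin

text \<open>
  Write \<open>s = |v|\<^sup>2 / 2\<close>, \<open>M = C e\<^sup>-\<^sup>s / (1 - k C e\<^sup>-\<^sup>s)\<close> for the quantum Maxwellian and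
  \<open>M\<^sub>0 = D e\<^sup>-\<^sup>s\<close> for the classical one of the same mass. The proof is a single-crossing argument.
  The quotient \<open>M / M\<^sub>0 = (C / D) / (1 - k C e\<^sup>-\<^sup>s)\<close> is strictly decreasing in \<open>s\<close> if \<open>k > 0\<close> and
  strictly increasing if \<open>k < 0\<close>, and equality of the masses forbids \<open>k (M - M\<^sub>0)\<close> to be positive
  everywhere; hence there is a level \<open>t\<close> with \<open>k (M - M\<^sub>0) (t - s) > 0\<close> whenever \<open>s \<noteq> t\<close>
  (lemma \<open>maxwellian_crossing\<close>). Integrating this product, the term with the constant \<open>t\<close> drops
  out because the masses agree, and what remains is \<open>-k\<close> times the difference of the energies, up
  to a positive factor (lemma \<open>second_moment_less_of_crossing\<close>). No energy has to be computed.

  The Maxwellians and their second moments are integrable because \<open>k C < 1\<close> keeps the denominator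
  away from \<open>0\<close>, so that they are dominated by a Gaussian. The normalizing constant is the
  unique one because \<open>M\<close> is strictly increasing in \<open>C\<close>.
\<close>

section \<open>Gaussian integrals and strict monotonicity of the integral\<close>

lemma integrable_gaussian_real:
  fixes a :: real
  assumes "a > 0"
  shows "integrable lborel (\<lambda>x::real. exp (- a * x\<^sup>2))"
proof -
  define \<sigma> where "\<sigma> = 1 / sqrt (2 * a)"
  have \<sigma>: "\<sigma> > 0" "2 * \<sigma>\<^sup>2 = 1 / a"
    using assms by (auto simp: \<sigma>_def power_divide real_sqrt_pow2)
  \<comment> \<open>\<open>\<sigma>\<close> is the standard deviation of the normal density proportional to \<open>exp (- a * x\<^sup>2)\<close>.\<close>
  have eq: "exp (- a * x\<^sup>2) = sqrt (2 * pi * \<sigma>\<^sup>2) * normal_density 0 \<sigma> x" for x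
    using \<sigma> assms by (auto simp: normal_density_def)
  show ?thesis
    unfolding eq using integrable_normal_density[OF \<sigma>(1)] by simp
qed

lemma integrable_gaussian:
  fixes a :: real
  assumes "a > 0"
  shows "integrable lborel (\<lambda>v::'a::euclidean_space. exp (- a * (norm v)\<^sup>2))"
proof -
  interpret P: product_sigma_finite "\<lambda>b::'a. lborel :: real measure"
    by standard
  have eq: "exp (- a * (norm (\<Sum>b\<in>Basis. f b *\<^sub>R b :: 'a))\<^sup>2) = (\<Prod>b\<in>Basis. exp (- a * (f b)\<^sup>2))"
    for f :: "'a \<Rightarrow> real"
  proof -
    have "(norm (\<Sum>b\<in>Basis. f b *\<^sub>R b :: 'a))\<^sup>2 = (\<Sum>b\<in>Basis. (f b)\<^sup>2)"
      unfolding power2_norm_eq_inner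
      by (subst euclidean_inner) (simp add: power2_eq_square)
    then show ?thesis
      by (simp only: exp_sum[OF finite_Basis, symmetric] sum_distrib_left)
  qed
  \<comment> \<open>Lebesgue measure is a product over the basis, along which the Gaussian factorizes.\<close>
  have "integrable (PiM Basis (\<lambda>b::'a. lborel)) (\<lambda>f. \<Prod>b\<in>Basis. exp (- a * (f b)\<^sup>2))"
    by (intro P.product_integrable_prod integrable_gaussian_real assms) auto
  then show ?thesis
    by (subst lborel_eq, subst integrable_distr_eq) (simp_all only: eq, measurable)
qed

lemma integrable_second_moment_gaussian:
  "integrable lborel (\<lambda>v::'a::euclidean_space. (norm v)\<^sup>2 * exp (- (norm v)\<^sup>2 / 2))"
proof (rule Bochner_Integration.integrable_bound)
  show "integrable lborel (\<lambda>v::'a. 4 * exp (- (1/4) * (norm v)\<^sup>2))"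
    by (intro integrable_mult_right integrable_gaussian) simp
  have bound: "r * exp (- r / 2) \<le> 4 * exp (- (1/4) * r)" if "r \<ge> 0" for r :: real
  proof -
    have "r / 4 \<le> exp (r / 4)"
      using exp_ge_add_one_self[of "r / 4"] by linarith
    then have "r * exp (- r / 2) \<le> 4 * exp (r / 4) * exp (- r / 2)"
      by (intro mult_right_mono) auto
    also have "\<dots> = 4 * exp (- (1/4) * r)"
      by (simp add: mult_exp_exp)
    finally show ?thesis .
  qed
  show "AE v in lborel. norm ((norm v)\<^sup>2 * exp (- (norm (v::'a))\<^sup>2 / 2))
      \<le> norm (4 * exp (- (1/4) * (norm v)\<^sup>2))"
    using bound by (auto simp: abs_mult)
qed measurable

lemma integral_lborel_less:
  fixes f g :: "'a::euclidean_space \<Rightarrow> real"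
  assumes "integrable lborel f" "integrable lborel g" "AE v in lborel. f v < g v"
  shows "integral\<^sup>L lborel f < integral\<^sup>L lborel g"
proof -
  have nonneg: "AE v in lborel. 0 \<le> g v - f v"
    using assms(3) by eventually_elim simp
  have "(LINT v|lborel. g v - f v) \<noteq> 0"
  proof
    assume "(LINT v|lborel. g v - f v) = 0"
    then have "AE v in lborel. g v - f v = 0"
      using assms nonneg by (subst (asm) integral_nonneg_eq_0_iff_AE) auto
    with assms(3) have "AE v in (lborel :: 'a measure). False"
      by eventually_elim simp
    then show False
      by (simp add: AE_iff_measurable[OF _ refl])
  qed
  moreover have "(LINT v|lborel. g v - f v) \<ge> 0"
    using nonneg by (rule integral_nonneg_AE)
  ultimately show ?thesis
    using assms by simp
qed

text \<open>
  If two densities have equal mass and one lies below the other inside a sphere and above it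
  outside, then it has the larger second moment.
\<close>

lemma second_moment_less_of_crossing:
  fixes f g :: "'a::euclidean_space \<Rightarrow> real"
  assumes int: "integrable lborel f" "integrable lborel g"
    and int2: "integrable lborel (\<lambda>v. (norm v)\<^sup>2 * f v)" "integrable lborel (\<lambda>v. (norm v)\<^sup>2 * g v)"
    and mass: "integral\<^sup>L lborel f = integral\<^sup>L lborel g"
    and cross: "\<And>v. (norm v)\<^sup>2 \<noteq> R \<Longrightarrow> ((norm v)\<^sup>2 - R) * (g v - f v) > 0"
  shows "(LINT v|lborel. (norm v)\<^sup>2 * f v) < (LINT v|lborel. (norm v)\<^sup>2 * g v)"
proof -
  have expand: "((norm v)\<^sup>2 - R) * (g v - f v)
      = ((norm v)\<^sup>2 * g v - (norm v)\<^sup>2 * f v) - R * (g v - f v)" for v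
    by (simp add: algebra_simps)
  have "negligible {v::'a. (norm v)\<^sup>2 = R}"
    by (rule negligible_subset[OF negligible_sphere[of 0 "sqrt R"]]) auto
  moreover have "{v::'a. (norm v)\<^sup>2 = R} \<in> sets lborel"
    by measurable
  ultimately have "{v::'a. (norm v)\<^sup>2 = R} \<in> null_sets lborel"
    by (simp add: negligible_iff_null_sets null_sets_completion_iff)
  then have ae: "AE v in lborel. (norm (v::'a))\<^sup>2 \<noteq> R"
    by (rule AE_I') auto
  have "(LINT v|(lborel :: 'a measure). 0) < (LINT v|lborel. ((norm v)\<^sup>2 - R) * (g v - f v))"
  proof (rule integral_lborel_less)
    show "integrable lborel (\<lambda>v. ((norm v)\<^sup>2 - R) * (g v - f v))"
      unfolding expand using int int2 by auto
    show "AE v in lborel. 0 < ((norm v)\<^sup>2 - R) * (g v - f v)"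
      using ae by eventually_elim (rule cross)
  qed simp
  then show ?thesis
    unfolding expand using int int2 mass by simp
qed

section \<open>Maxwellians\<close>

text \<open>
  The denominator is bounded below by a positive constant independent of \<open>v\<close>: it is at least
  \<open>1 - k C\<close> if \<open>k C \<ge> 0\<close>, and greater than \<open>1\<close> otherwise.
\<close>

lemma maxwellian_denom_pos:
  fixes v :: "real ^ 'n"
  assumes "k * C < 1"
  shows "0 < min 1 (1 - k * C)" "min 1 (1 - k * C) \<le> 1 - k * C * exp (- (norm v)\<^sup>2 / 2)"
proof -
  let ?e = "exp (- (norm v)\<^sup>2 / 2)"
  show "0 < min 1 (1 - k * C)"
    using assms by simp
  have e: "0 < ?e" "?e \<le> 1"
    by auto
  show "min 1 (1 - k * C) \<le> 1 - k * C * ?e"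
  proof (cases "k * C \<ge> 0")
    case True
    then show ?thesis using mult_left_le[OF e(2) True] by linarith
  next
    case False
    then have "k * C * ?e < 0" using e(1) by (simp add: mult_neg_pos)
    then show ?thesis by linarith
  qed
qed

lemma maxwellian_le_gaussian:
  fixes v :: "real ^ 'n"
  assumes "C > 0" "k * C < 1"
  shows "0 < maxwellian k C v"
    and "maxwellian k C v \<le> C / min 1 (1 - k * C) * exp (- (norm v)\<^sup>2 / 2)"
proof -
  note d = maxwellian_denom_pos(1)[OF assms(2)] maxwellian_denom_pos(2)[OF assms(2), of v]
  show "0 < maxwellian k C v"
    unfolding maxwellian_def using assms(1) d by (intro divide_pos_pos) auto
  show "maxwellian k C v \<le> C / min 1 (1 - k * C) * exp (- (norm v)\<^sup>2 / 2)"
    unfolding maxwellian_def times_divide_eq_left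
    using assms(1) d by (intro divide_left_mono mult_pos_pos) auto
qed

lemma maxwellian_measurable [measurable]: "maxwellian k C \<in> borel_measurable borel"
  unfolding maxwellian_def by measurable

lemma integrable_maxwellian:
  assumes "C > 0" "k * C < 1"
  shows "integrable lborel (maxwellian k C :: real ^ 'n \<Rightarrow> real)"
    and "integrable lborel (\<lambda>v :: real ^ 'n. (norm v)\<^sup>2 * maxwellian k C v)"
proof -
  let ?B = "C / min 1 (1 - k * C)"
  note b = maxwellian_le_gaussian[OF assms]
  have B: "?B > 0"
    using assms by simp
  show "integrable lborel (maxwellian k C :: real ^ 'n \<Rightarrow> real)"
  proof (rule Bochner_Integration.integrable_bound)
    show "integrable lborel (\<lambda>v::real ^ 'n. ?B * exp (- (norm v)\<^sup>2 / 2))"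
      using integrable_gaussian[of "1/2", where 'a = "real ^ 'n"] by (intro integrable_mult_right) simp
    show "AE v in lborel. norm (maxwellian k C (v :: real ^ 'n))
        \<le> norm (?B * exp (- (norm v)\<^sup>2 / 2))"
    proof (intro AE_I2)
      fix v :: "real ^ 'n"
      show "norm (maxwellian k C v) \<le> norm (?B * exp (- (norm v)\<^sup>2 / 2))"
        using b[of v] unfolding real_norm_def by linarith
    qed
  qed measurable
  show "integrable lborel (\<lambda>v :: real ^ 'n. (norm v)\<^sup>2 * maxwellian k C v)"
  proof (rule Bochner_Integration.integrable_bound)
    show "integrable lborel (\<lambda>v::real ^ 'n. ?B * ((norm v)\<^sup>2 * exp (- (norm v)\<^sup>2 / 2)))"
      by (intro integrable_mult_right integrable_second_moment_gaussian)
    show "AE v in lborel. norm ((norm v)\<^sup>2 * maxwellian k C (v :: real ^ 'n))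
        \<le> norm (?B * ((norm v)\<^sup>2 * exp (- (norm v)\<^sup>2 / 2)))"
    proof (intro AE_I2)
      fix v :: "real ^ 'n"
      have "(norm v)\<^sup>2 * maxwellian k C v \<le> ?B * ((norm v)\<^sup>2 * exp (- (norm v)\<^sup>2 / 2))"
        using mult_left_mono[OF b(2)[of v], of "(norm v)\<^sup>2"] by (simp add: mult_ac)
      moreover have "0 \<le> (norm v)\<^sup>2 * maxwellian k C v"
        using b(1)[of v] by simp
      ultimately show "norm ((norm v)\<^sup>2 * maxwellian k C v)
          \<le> norm (?B * ((norm v)\<^sup>2 * exp (- (norm v)\<^sup>2 / 2)))"
        unfolding real_norm_def by linarith
    qed
  qed measurable
qed

lemma maxwellian_strict_mono:
  fixes v :: "real ^ 'n"
  assumes "0 < C" "C < C'" "k * C < 1" "k * C' < 1"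
  shows "maxwellian k C v < maxwellian k C' v"
proof -
  have d: "0 < 1 - k * C * exp (- (norm v)\<^sup>2 / 2)" "0 < 1 - k * C' * exp (- (norm v)\<^sup>2 / 2)"
    using maxwellian_denom_pos(1)[OF assms(3)] maxwellian_denom_pos(2)[OF assms(3), of v]
      maxwellian_denom_pos(1)[OF assms(4)] maxwellian_denom_pos(2)[OF assms(4), of v] by linarith+
  have "C * exp (- (norm v)\<^sup>2 / 2) < C' * exp (- (norm v)\<^sup>2 / 2)"
    using assms by simp
  then show ?thesis
    unfolding maxwellian_def using d by (simp add: divide_simps) (simp add: algebra_simps)
qed

section \<open>The normalizing constant\<close>

lemma normalizing_const_eq:
  fixes \<Omega> :: "(real ^ 'n) set"
  assumes "is_normalizing_const \<Omega> \<rho> k C" "\<rho> > 0"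
  shows "normalizing_const \<Omega> \<rho> k = C"
proof -
  have False if "is_normalizing_const \<Omega> \<rho> k C\<^sub>1" "is_normalizing_const \<Omega> \<rho> k C\<^sub>2" "C\<^sub>1 < C\<^sub>2"
    for C\<^sub>1 C\<^sub>2
  proof -
    have C: "0 < C\<^sub>1" "0 < C\<^sub>2" "k * C\<^sub>1 < 1" "k * C\<^sub>2 < 1"
      using that by (simp_all add: is_normalizing_const_def)
    have "(LINT v|lborel. maxwellian k C\<^sub>1 (v :: real ^ 'n))
        < (LINT v|lborel. maxwellian k C\<^sub>2 (v :: real ^ 'n))"
      by (rule integral_lborel_less[OF integrable_maxwellian(1)[OF C(1,3)]
          integrable_maxwellian(1)[OF C(2,4)]])
        (intro AE_I2 maxwellian_strict_mono C \<open>C\<^sub>1 < C\<^sub>2\<close>)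
    then show False
      using that \<open>\<rho> > 0\<close> unfolding is_normalizing_const_def
      by (metis less_irrefl mult_cancel_left mult_zero_left)
  qed
  then have "C' = C" if "is_normalizing_const \<Omega> \<rho> k C'" for C'
    using assms(1) that by (meson linorder_less_linear)
  then show ?thesis
    unfolding normalizing_const_def using assms(1) by (intro the_equality)
qed

lemma classical_normalizing_const_exists:
  fixes \<Omega> :: "(real ^ 'n) set"
  assumes "measure lborel \<Omega> > 0" "\<rho> > 0"
  shows "\<exists>D. is_normalizing_const \<Omega> \<rho> 0 D"
proof -
  define G where "G = (LINT v|lborel. maxwellian 0 1 (v :: real ^ 'n))"
  have "(LINT v|(lborel :: (real ^ 'n) measure). 0) < G"
    unfolding G_def
    by (intro integral_lborel_less integrable_maxwellian AE_I2 maxwellian_le_gaussian) auto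
  then have G: "G > 0"
    by simp
  have "(LINT v|lborel. maxwellian 0 D (v :: real ^ 'n)) = D * G" for D
    by (simp add: G_def maxwellian_def)
  then have "is_normalizing_const \<Omega> \<rho> 0 (\<rho> / (measure lborel \<Omega> * G))"
    unfolding is_normalizing_const_def using assms G by simp
  then show ?thesis by blast
qed

section \<open>Comparison of the energies\<close>

text \<open>
  Subtracting, \<open>M - M\<^sub>0 = e\<^sup>-\<^sup>s (k C D e\<^sup>-\<^sup>s - (D - C)) / (1 - k C e\<^sup>-\<^sup>s)\<close>. If \<open>(D - C) / k\<close>
  were not positive, \<open>k (M - M\<^sub>0)\<close> would be positive everywhere. So the crossing level \<open>t\<close> with
  \<open>e\<^sup>-\<^sup>t = (D - C) / (k C D)\<close> exists; \<open>t\<close> may have either sign.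
\<close>

lemma maxwellian_crossing:
  fixes k C D :: real
  assumes "k \<noteq> 0" "C > 0" "k * C < 1" "D > 0"
    and mass: "(LINT v|lborel. maxwellian k C (v :: real ^ 'n))
      = (LINT v|lborel. maxwellian 0 D (v :: real ^ 'n))"
  obtains t where "\<And>v :: real ^ 'n. (norm v)\<^sup>2 / 2 \<noteq> t \<Longrightarrow>
    k * (maxwellian k C v - maxwellian 0 D v) * (t - (norm v)\<^sup>2 / 2) > 0"
proof -
  define e where "e v = exp (- (norm v)\<^sup>2 / 2)" for v :: "real ^ 'n"
  have e: "e v > 0" for v
    by (simp add: e_def)
  have d: "0 < 1 - k * C * e v" for v
    using maxwellian_denom_pos(1)[OF assms(3)] maxwellian_denom_pos(2)[OF assms(3), of v]
    unfolding e_def by linarith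
  have diff: "k * (maxwellian k C v - maxwellian 0 D v)
      = e v * (k\<^sup>2 * C * D * e v - k * (D - C)) / (1 - k * C * e v)" for v :: "real ^ 'n"
    using d[of v] unfolding maxwellian_def e_def[symmetric]
    by (simp add: field_simps power2_eq_square)
  have kCD: "k\<^sup>2 * C * D > 0"
    using assms by simp
  have "k * (D - C) > 0"
  proof (rule ccontr)
    assume neg: "\<not> k * (D - C) > 0"
    have "(LINT v|(lborel :: (real ^ 'n) measure). 0)
        < (LINT v|lborel. k * (maxwellian k C v - maxwellian 0 D (v :: real ^ 'n)))"
    proof (intro integral_lborel_less AE_I2)
      show "integrable lborel (\<lambda>v :: real ^ 'n. k * (maxwellian k C v - maxwellian 0 D v))"
        using assms by (intro integrable_mult_right Bochner_Integration.integrable_diff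
          integrable_maxwellian) auto
      fix v :: "real ^ 'n"
      have "k\<^sup>2 * C * D * e v > 0"
        using kCD e by (rule mult_pos_pos)
      then have "k\<^sup>2 * C * D * e v - k * (D - C) > 0"
        using neg by linarith
      then show "0 < k * (maxwellian k C v - maxwellian 0 D v)"
        unfolding diff using e d by (intro divide_pos_pos mult_pos_pos)
    qed simp
    also have "\<dots> = 0"
      using mass assms by (simp add: integrable_maxwellian)
    finally show False by simp
  qed
  then have pos: "k * (D - C) / (k\<^sup>2 * C * D) > 0"
    using kCD by (rule divide_pos_pos)
  define t where "t = - ln (k * (D - C) / (k\<^sup>2 * C * D))"
  have t: "k * (D - C) = k\<^sup>2 * C * D * exp (- t)"
    using pos assms by (simp add: t_def)
  have "k * (maxwellian k C v - maxwellian 0 D v) * (t - (norm v)\<^sup>2 / 2) > 0"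
    if ne: "(norm v)\<^sup>2 / 2 \<noteq> t" for v :: "real ^ 'n"
  proof -
    have "(e v - exp (- t)) * (t - (norm v)\<^sup>2 / 2) > 0"
    proof (cases "(norm v)\<^sup>2 / 2 < t")
      case True
      then show ?thesis by (intro mult_pos_pos) (auto simp: e_def)
    next
      case False
      then show ?thesis using ne by (intro mult_neg_neg) (auto simp: e_def)
    qed
    then have "e v * (k\<^sup>2 * C * D) / (1 - k * C * e v) * ((e v - exp (- t)) * (t - (norm v)\<^sup>2 / 2)) > 0"
      by (intro mult_pos_pos[OF divide_pos_pos[OF mult_pos_pos[OF e kCD] d]])
    also have "e v * (k\<^sup>2 * C * D) / (1 - k * C * e v) * ((e v - exp (- t)) * (t - (norm v)\<^sup>2 / 2))
        = k * (maxwellian k C v - maxwellian 0 D v) * (t - (norm v)\<^sup>2 / 2)"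
      unfolding diff t right_diff_distrib[symmetric, of "k\<^sup>2 * C * D"] by simp
    finally show ?thesis .
  qed
  then show ?thesis
    by (rule that)
qed

lemma maxwellian_second_moment_compare:
  fixes k C D :: real
  assumes "k \<noteq> 0" "C > 0" "k * C < 1" "D > 0"
    and mass: "(LINT v|lborel. maxwellian k C (v :: real ^ 'n))
      = (LINT v|lborel. maxwellian 0 D (v :: real ^ 'n))"
  defines "E \<equiv> LINT v|lborel. (norm v)\<^sup>2 * maxwellian k C (v :: real ^ 'n)"
    and "E\<^sub>0 \<equiv> LINT v|lborel. (norm v)\<^sup>2 * maxwellian 0 D (v :: real ^ 'n)"
  shows "k > 0 \<Longrightarrow> E < E\<^sub>0" and "k < 0 \<Longrightarrow> E\<^sub>0 < E"
proof -
  obtain t where t: "\<And>v :: real ^ 'n. (norm v)\<^sup>2 / 2 \<noteq> t \<Longrightarrow>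
      k * (maxwellian k C v - maxwellian 0 D v) * (t - (norm v)\<^sup>2 / 2) > 0"
    using maxwellian_crossing[OF assms(1-5)] by blast
  have cross: "k * (((norm v)\<^sup>2 - 2 * t) * (maxwellian 0 D v - maxwellian k C v)) > 0"
    if "(norm v)\<^sup>2 \<noteq> 2 * t" for v :: "real ^ 'n"
  proof -
    have "0 < 2 * (k * (maxwellian k C v - maxwellian 0 D v) * (t - (norm v)\<^sup>2 / 2))"
      using t[of v] that by simp
    also have "\<dots> = k * (((norm v)\<^sup>2 - 2 * t) * (maxwellian 0 D v - maxwellian k C v))"
      by (simp add: algebra_simps)
    finally show ?thesis .
  qed
  show "E < E\<^sub>0" if "k > 0"
    unfolding E_def E\<^sub>0_def
  proof (rule second_moment_less_of_crossing[where R = "2 * t"])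
    show "((norm v)\<^sup>2 - 2 * t) * (maxwellian 0 D v - maxwellian k C v) > 0"
      if "(norm v)\<^sup>2 \<noteq> 2 * t" for v :: "real ^ 'n"
      using cross[OF that] \<open>k > 0\<close> by (simp only: zero_less_mult_pos)
  qed (use assms in \<open>auto intro: integrable_maxwellian\<close>)
  show "E\<^sub>0 < E" if "k < 0"
    unfolding E_def E\<^sub>0_def
  proof (rule second_moment_less_of_crossing[where R = "2 * t"])
    show "((norm v)\<^sup>2 - 2 * t) * (maxwellian k C v - maxwellian 0 D v) > 0"
      if "(norm v)\<^sup>2 \<noteq> 2 * t" for v :: "real ^ 'n"
    proof -
      have "((norm v)\<^sup>2 - 2 * t) * (maxwellian 0 D v - maxwellian k C v) < 0"
        using cross[OF that] \<open>k < 0\<close> by (auto simp only: zero_less_mult_iff)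
      then show ?thesis
        by (simp add: algebra_simps)
    qed
  qed (use assms in \<open>auto intro: integrable_maxwellian\<close>)
qed

lemma energy_eq:
  assumes "\<Omega> \<in> sets lborel"
  shows "energy \<Omega> f = 1 / 2 * measure lborel \<Omega> * (LINT v|lborel. (norm v)\<^sup>2 * f v)"
  using assms by (simp add: energy_def set_lebesgue_integral_def)

theorem proposition2p10:
  fixes \<Omega> :: "(real ^ 'n) set" and \<rho> k :: real
  assumes "bounded_domain \<Omega>"
    and "\<rho> > 0"
    and "k \<noteq> 0"
    and "\<exists>C. is_normalizing_const \<Omega> \<rho> k C"
    and "-1 \<le> k * normalizing_const \<Omega> \<rho> k"
    and "k * normalizing_const \<Omega> \<rho> k < 1"
  shows "(k > 0 \<longrightarrow> quantum_energy \<Omega> \<rho> k < classical_energy \<Omega> \<rho>) \<and>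
         (k < 0 \<longrightarrow> classical_energy \<Omega> \<rho> < quantum_energy \<Omega> \<rho> k)"
proof -
  obtain C where C: "is_normalizing_const \<Omega> \<rho> k C"
    using assms(4) by blast
  \<comment> \<open>The mass equation already forces the volume to be nonzero.\<close>
  have vol: "measure lborel \<Omega> > 0"
    using C \<open>\<rho> > 0\<close> measure_nonneg[of lborel \<Omega>] unfolding is_normalizing_const_def
    by (metis mult_zero_left order_le_less)
  obtain D where D: "is_normalizing_const \<Omega> \<rho> 0 D"
    using classical_normalizing_const_exists[OF vol \<open>\<rho> > 0\<close>] by blast
  have "measure lborel \<Omega> * (LINT v|lborel. maxwellian k C (v :: real ^ 'n))
      = measure lborel \<Omega> * (LINT v|lborel. maxwellian 0 D (v :: real ^ 'n))"
    using C D unfolding is_normalizing_const_def by simp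
  then have mass: "(LINT v|lborel. maxwellian k C (v :: real ^ 'n))
      = (LINT v|lborel. maxwellian 0 D (v :: real ^ 'n))"
    using vol by simp
  have CD: "C > 0" "k * C < 1" "D > 0"
    using C D by (auto simp: is_normalizing_const_def)
  have meas: "\<Omega> \<in> sets lborel"
    using assms(1) by (simp add: bounded_domain_def)
  show ?thesis
    using maxwellian_second_moment_compare[OF \<open>k \<noteq> 0\<close> CD mass] vol
    by (simp add: quantum_energy_def classical_energy_def global_maxwellian_def energy_eq[OF meas]
      normalizing_const_eq[OF C \<open>\<rho> > 0\<close>] normalizing_const_eq[OF D \<open>\<rho> > 0\<close>])
qed

end
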